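(* Let $\nu$ be a positive measure on $(0,\infty)$ with $\int_0^\infty(1\wedge t)\,\nu(\mathrm dt)<\infty$, and let $\phi(\lambda)=\int_0^\infty(1-e^{-t\lambda})\,\nu(\mathrm dt)$ for $\lambda\ge0$ (a driftless Bernstein function with $\phi(0)=0$). Let $f:\{-1,1\}^n\to[-1,1]$. If $V$ is a vector field on $\{-1,1\}^n$ satisfying $\operatorname{div}V=Lf$, then $$\langle f,\phi(L)f\rangle\ \le\ \mathbb E_x\,\Gamma_\phi(V(x)).$$ Consequently, $$\langle f,\phi(L)f\rangle\ \le\ \inf_{\operatorname{div}V=Lf}\mathbb E_x\,\Gamma_\phi(V(x)).$$
   Context: $\{-1,1\}^n$ carries the uniform probability measure and $\langle g,h\rangle=\mathbb E[gh]$. $x^{\oplus i}$ is $x$ with the $i$th coordinate flipped; $D_ig(x)=\frac{g(x)-g(x^{\oplus i})}2$; $L=\sum_{i=1}^nD_i$. With $\chi_S(x)=\prod_{i\in S}x_i$ one has $L\chi_S=|S|\chi_S$, and $\phi(L)$ is the linear operator with $\phi(L)\chi_S=\phi(|S|)\chi_S$. A vector field is a map $V=(V_1,\dots,V_n):\{-1,1\}^n\to\mathbb R^n$, with $\operatorname{div}V(x)=\sum_{i=1}^n(V_i(x)-V_i(x^{\oplus i}))$. For $t>0$ put $\rho=e^{-t}$, let $\varepsilon_1(t),\dots,\varepsilon_n(t)$ be independent $\pm1$-valued random variables with $\mathbb E\varepsilon_i(t)=\rho$, and let $\delta_i(t)=\frac{\varepsilon_i(t)-\rho}{\sqrt{1-\rho^2}}$.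 For $a\in\mathbb R^n$ define $$\Psi_t(a)=\frac1{\sqrt{e^{2t}-1}}\,\mathbb E\Big|\sum_{i=1}^na_i\delta_i(t)\Big|.$$ Put $\eta_\phi(s)=\nu([s,\infty))$ and $$\Gamma_\phi(a)=2\int_0^\infty\eta_\phi(s)\,\Psi_s(a)\,\mathrm ds\in[0,+\infty].$$ *)

theory Defs
  imports "HOL-Analysis.Analysis" "HOL-Probability.Probability"
begin

section \<open>Analysis on the discrete cube\<close>

text \<open>Functions on the cube and vector fields are total functions on \<open>real ^ 'n\<close> of which only the
  values on \<^term>\<open>cube\<close> are ever used.\<close>

definition cube :: "(real ^ 'n) set" where
  "cube = {x. \<forall>i. x $ i \<in> {-1, 1}}"

definition cube_expectation :: "(real ^ 'n \<Rightarrow> real) \<Rightarrow> real" where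
  "cube_expectation g = measure_pmf.expectation (pmf_of_set cube) g"

definition cube_inner :: "(real ^ 'n \<Rightarrow> real) \<Rightarrow> (real ^ 'n \<Rightarrow> real) \<Rightarrow> real" where
  "cube_inner g h = cube_expectation (\<lambda>x. g x * h x)"

definition cube_flip :: "'n \<Rightarrow> real ^ 'n \<Rightarrow> real ^ 'n" where
  "cube_flip i x = (\<chi> j. if j = i then - (x $ j) else x $ j)"

definition cube_D :: "'n \<Rightarrow> (real ^ 'n \<Rightarrow> real) \<Rightarrow> real ^ 'n \<Rightarrow> real" where
  "cube_D i g x = (g x - g (cube_flip i x)) / 2"

definition cube_L :: "(real ^ 'n \<Rightarrow> real) \<Rightarrow> real ^ 'n \<Rightarrow> real" where
  "cube_L g x = (\<Sum>i\<in>UNIV. cube_D i g x)"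

definition cube_div :: "(real ^ 'n \<Rightarrow> real ^ 'n) \<Rightarrow> real ^ 'n \<Rightarrow> real" where
  "cube_div V x = (\<Sum>i\<in>UNIV. V x $ i - V (cube_flip i x) $ i)"

definition walsh :: "'n set \<Rightarrow> real ^ 'n \<Rightarrow> real" where
  "walsh S x = (\<Prod>i\<in>S. x $ i)"

text \<open>The operator \<open>\<phi>(L)\<close>, given on all functions by extending \<open>\<phi>(L) \<chi>\<^sub>S = \<phi>(|S|) \<chi>\<^sub>S\<close> linearly along the
  Walsh basis; \<open>fun_of_L_walsh\<close>, \<open>fun_of_L_linear\<close> and \<open>walsh_expansion\<close> below show that this is
  the unique linear operator on functions on the cube with that property.\<close>

definition fun_of_L :: "(real \<Rightarrow> real) \<Rightarrow> (real ^ 'n \<Rightarrow> real) \<Rightarrow> real ^ 'n \<Rightarrow> real" where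
  "fun_of_L \<phi> g x = (\<Sum>S\<in>UNIV. \<phi> (real (card S)) * cube_inner g (walsh S) * walsh S x)"


section \<open>Bernstein functions and the functional \<open>\<Gamma>\<^sub>\<phi>\<close>\<close>

definition bernstein_of :: "real measure \<Rightarrow> real \<Rightarrow> real" where
  "bernstein_of \<nu> l = (LINT t|\<nu>. 1 - exp (- t * l))"

text \<open>The joint law of independent \<open>\<epsilon>\<^sub>i\<close> with values \<open>\<plusminus>1\<close> and mean \<open>\<rho>\<close>: \<open>\<epsilon>\<^sub>i\<close> is \<open>1\<close> with probability
  \<open>(1 + \<rho>) / 2\<close>.\<close>

definition eps_law :: "real \<Rightarrow> ('n \<Rightarrow> real) pmf" where
  "eps_law \<rho> = Pi_pmf UNIV 0 (\<lambda>_. map_pmf (\<lambda>b. if b then 1 else - 1) (bernoulli_pmf ((1 + \<rho>) / 2)))"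

definition Psi :: "real \<Rightarrow> real ^ 'n \<Rightarrow> real" where
  "Psi t a = (let \<rho> = exp (- t) in
     1 / sqrt (exp (2 * t) - 1) *
     measure_pmf.expectation (eps_law \<rho>)
       (\<lambda>\<epsilon>. \<bar>\<Sum>i\<in>UNIV. a $ i * ((\<epsilon> i - \<rho>) / sqrt (1 - \<rho>\<^sup>2))\<bar>))"

definition eta :: "real measure \<Rightarrow> real \<Rightarrow> ennreal" where
  "eta \<nu> s = emeasure \<nu> {s..}"

definition Gamma_phi :: "real measure \<Rightarrow> real ^ 'n \<Rightarrow> ennreal" where
  "Gamma_phi \<nu> a = 2 * (\<integral>\<^sup>+ s\<in>{0<..}. eta \<nu> s * ennreal (Psi s a) \<partial>lborel)"


section \<open>Consistency of the definitions\<close>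

lemma finite_cube [simp]: "finite (cube :: (real ^ 'n) set)"
proof -
  have "(cube :: (real ^ 'n) set) \<subseteq> vec_lambda ` (UNIV \<rightarrow>\<^sub>E {-1, 1 :: real})"
  proof
    fix x :: "real ^ 'n" assume "x \<in> cube"
    then have "($) x \<in> UNIV \<rightarrow>\<^sub>E {-1, 1}" by (auto simp: cube_def PiE_def)
    then show "x \<in> vec_lambda ` (UNIV \<rightarrow>\<^sub>E {-1, 1 :: real})"
      by (rule image_eqI[rotated]) (simp add: vec_nth_inverse)
  qed
  moreover have "finite (vec_lambda ` ((UNIV :: 'n set) \<rightarrow>\<^sub>E {-1, 1 :: real}))"
    by (intro finite_imageI finite_PiE) auto
  ultimately show ?thesis by (rule finite_subset)
qed

lemma cube_sq: "x \<in> cube \<Longrightarrow> x $ i * x $ i = 1"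
  unfolding cube_def using square_eq_1_iff[of "x $ i"] by auto

lemma cube_nonempty [simp]: "cube \<noteq> {}"
proof -
  have "(\<chi> i. 1) \<in> cube" by (simp add: cube_def)
  then show ?thesis by blast
qed

lemma cube_flip_flip [simp]: "cube_flip i (cube_flip i x) = x"
  by (simp add: cube_flip_def vec_eq_iff)

lemma cube_flip_in [simp]: "cube_flip i x \<in> cube \<longleftrightarrow> x \<in> cube"
  unfolding cube_def cube_flip_def by (auto simp: minus_equation_iff[of _ 1])

lemma cube_expectation_eq: "cube_expectation g = (\<Sum>x\<in>cube. g x) / real (card (cube :: (real ^ 'n) set))"
  for g :: "real ^ 'n \<Rightarrow> real"
  unfolding cube_expectation_def by (simp add: integral_pmf_of_set)

lemma cube_expectation_flip: "cube_expectation (\<lambda>x. g (cube_flip i x)) = cube_expectation g"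
proof -
  have "bij_betw (cube_flip i) cube cube"
    by (rule bij_betw_byWitness[where f' = "cube_flip i"]) auto
  then show ?thesis
    unfolding cube_expectation_eq by (simp add: sum.reindex_bij_betw)
qed

lemma walsh_flip: "walsh S (cube_flip i x) = (if i \<in> S then - walsh S x else walsh S x)"
proof (cases "i \<in> S")
  case True
  have "walsh S y = y $ i * (\<Prod>j\<in>S - {i}. y $ j)" for y :: "real ^ 'a"
    unfolding walsh_def using True by (simp add: prod.remove)
  moreover have "(\<Prod>j\<in>S - {i}. cube_flip i x $ j) = (\<Prod>j\<in>S - {i}. x $ j)"
    by (rule prod.cong) (auto simp: cube_flip_def)
  ultimately show ?thesis using True by (simp add: cube_flip_def)
next
  case False
  then show ?thesis unfolding walsh_def
    by (auto intro!: prod.cong simp: cube_flip_def)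
qed

lemma cube_L_walsh: "cube_L (walsh S) x = real (card S) * walsh S x"
proof -
  have "cube_L (walsh S) x = (\<Sum>i\<in>UNIV. if i \<in> S then walsh S x else 0)"
    unfolding cube_L_def cube_D_def by (intro sum.cong) (auto simp: walsh_flip)
  then show ?thesis by (simp add: sum.If_cases)
qed

lemma walsh_orthonormal: "cube_inner (walsh S) (walsh T) = (if S = T then 1 else 0)"
  for S T :: "'n::finite set"
proof (cases "S = T")
  case True
  have "walsh S x * walsh S x = 1" if "x \<in> cube" for x :: "real ^ 'n"
  proof -
    have "x $ i * x $ i = 1" for i
      using that by (rule cube_sq)
    then show ?thesis unfolding walsh_def prod.distrib[symmetric] by simp
  qed
  then show ?thesis using True
    by (simp add: cube_inner_def cube_expectation_eq)
next
  case False
  then obtain i where i: "i \<in> S \<longleftrightarrow> i \<notin> T" by blast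
  have "cube_expectation (\<lambda>x. walsh S x * walsh T x)
      = cube_expectation (\<lambda>x. walsh S (cube_flip i x) * walsh T (cube_flip i x))"
    by (rule cube_expectation_flip[symmetric])
  also have "\<dots> = cube_expectation (\<lambda>x. - (walsh S x * walsh T x))"
    using i by (intro arg_cong[where f = cube_expectation]) (auto simp: walsh_flip fun_eq_iff)
  also have "\<dots> = - cube_expectation (\<lambda>x. walsh S x * walsh T x)"
    by (simp add: cube_expectation_def)
  finally show ?thesis using False by (simp add: cube_inner_def)
qed

lemma fun_of_L_walsh: "fun_of_L \<phi> (walsh S) x = \<phi> (real (card S)) * walsh S x"
  unfolding fun_of_L_def walsh_orthonormal
  by (simp add: if_distrib if_distribR cong: if_cong)

lemma cube_inner_linear:
  "cube_inner (\<lambda>x. a * g x + b * h x) k = a * cube_inner g k + b * cube_inner h k"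
  unfolding cube_inner_def cube_expectation_eq
  by (simp add: algebra_simps sum.distrib sum_distrib_left add_divide_distrib)

lemma fun_of_L_linear:
  "fun_of_L \<phi> (\<lambda>x. a * g x + b * h x) x = a * fun_of_L \<phi> g x + b * fun_of_L \<phi> h x"
  unfolding fun_of_L_def cube_inner_linear
  by (simp add: algebra_simps sum.distrib sum_distrib_left)

lemma walsh_kernel:
  fixes x y :: "real ^ 'n"
  assumes "x \<in> cube" "y \<in> cube"
  shows "(\<Sum>S\<in>UNIV. walsh S y * walsh S x) = (if x = y then 2 ^ CARD('n) else 0)"
proof -
  have "(\<Sum>S\<in>UNIV. walsh S y * walsh S x) = (\<Prod>i\<in>UNIV. y $ i * x $ i + 1)"
    by (simp add: prod_add walsh_def prod.distrib)
  also have "\<dots> = (if x = y then 2 ^ CARD('n) else 0)"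
  proof (cases "x = y")
    case True
    have "y $ i * x $ i + 1 = 2" for i
      using True cube_sq[OF assms(1), of i] by simp
    then show ?thesis using True by simp
  next
    case False
    then obtain i where "x $ i \<noteq> y $ i" by (auto simp: vec_eq_iff)
    moreover have "x $ i \<in> {-1, 1}" "y $ i \<in> {-1, 1}" using assms by (auto simp: cube_def)
    ultimately have "y $ i * x $ i + 1 = 0" by auto
    then show ?thesis using False by (auto intro!: prod_zero)
  qed
  finally show ?thesis .
qed

lemma card_cube: "card (cube :: (real ^ 'n) set) = 2 ^ CARD('n)"
proof -
  have "bij_betw (\<lambda>x::real ^ 'n. ($) x) cube (UNIV \<rightarrow>\<^sub>E {-1, 1})"
    by (rule bij_betw_byWitness[where f' = vec_lambda]) (auto simp: cube_def PiE_def)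
  then have "card (cube :: (real ^ 'n) set) = card ((UNIV :: 'n set) \<rightarrow>\<^sub>E {-1, 1 :: real})"
    by (rule bij_betw_same_card)
  then show ?thesis by (simp add: card_PiE numeral_2_eq_2)
qed

lemma walsh_expansion:
  fixes g :: "real ^ 'n \<Rightarrow> real"
  assumes "x \<in> cube"
  shows "g x = (\<Sum>S\<in>UNIV. cube_inner g (walsh S) * walsh S x)"
proof -
  have "(\<Sum>S\<in>UNIV. cube_inner g (walsh S) * walsh S x)
      = (\<Sum>S\<in>UNIV. \<Sum>y\<in>cube. g y * (walsh S y * walsh S x)) / 2 ^ CARD('n)"
    by (simp add: cube_inner_def cube_expectation_eq card_cube sum_distrib_right
        sum_divide_distrib mult.assoc)
  also have "\<dots> = (\<Sum>y\<in>cube. g y * (\<Sum>S\<in>UNIV. walsh S y * walsh S x)) / 2 ^ CARD('n)"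
    by (subst sum.swap) (simp add: sum_distrib_left)
  also have "\<dots> = (\<Sum>y\<in>cube. if y = x then g y * 2 ^ CARD('n) else 0) / 2 ^ CARD('n)"
    using assms by (intro arg_cong2[where f = "(/)"] sum.cong) (auto simp: walsh_kernel)
  also have "\<dots> = g x" using assms by (simp add: sum.delta)
  finally show ?thesis by simp
qed

lemma eps_law_indep:
  "prob_space.indep_vars (measure_pmf (eps_law \<rho> :: ('n::finite \<Rightarrow> real) pmf))
     (\<lambda>_. count_space UNIV) (\<lambda>i \<epsilon>. \<epsilon> i) UNIV"
  unfolding eps_law_def by (rule indep_vars_Pi_pmf) simp

lemma eps_law_component:
  "map_pmf (\<lambda>\<epsilon>. \<epsilon> i) (eps_law \<rho>)
     = map_pmf (\<lambda>b. if b then 1 else - 1) (bernoulli_pmf ((1 + \<rho>) / 2))"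
  for i :: "'n::finite"
  unfolding eps_law_def by (simp add: Pi_pmf_component)

lemma eps_law_values: "\<epsilon> \<in> set_pmf (eps_law \<rho>) \<Longrightarrow> \<epsilon> i \<in> {-1, 1}"
  for i :: "'n::finite"
  unfolding eps_law_def by (auto simp: set_Pi_pmf PiE_dflt_def split: if_splits)

lemma eps_law_mean:
  fixes i :: "'n::finite"
  assumes "\<bar>\<rho>\<bar> \<le> 1"
  shows "measure_pmf.expectation (eps_law \<rho>) (\<lambda>\<epsilon>. \<epsilon> i) = \<rho>"
proof -
  have "measure_pmf.expectation (eps_law \<rho>) (\<lambda>\<epsilon>. \<epsilon> i)
      = measure_pmf.expectation (map_pmf (\<lambda>\<epsilon>. \<epsilon> i) (eps_law \<rho>)) (\<lambda>z. z)"
    by simp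
  also have "\<dots> = \<rho>"
    unfolding eps_law_component using assms by (simp add: field_simps)
  finally show ?thesis .
qed

lemma bernstein_integrable:
  fixes \<nu> :: "real measure"
  assumes "sets \<nu> = sets (restrict_space borel {0<..})"
    and "(\<integral>\<^sup>+ t. ennreal (min 1 t) \<partial>\<nu>) < \<infinity>" and "l \<ge> 0"
  shows "integrable \<nu> (\<lambda>t. 1 - exp (- t * l))"
proof (rule integrableI_bounded)
  have sp: "space \<nu> = {0<..}"
    using sets_eq_imp_space_eq[OF assms(1)] by (simp add: space_restrict_space)
  have meas: "h \<in> borel_measurable \<nu>" if "h \<in> borel_measurable borel" for h :: "real \<Rightarrow> real"
    using that measurable_cong_sets[OF assms(1) refl] measurable_restrict_space1 by blast
  show "(\<lambda>t. 1 - exp (- t * l)) \<in> borel_measurable \<nu>" by (rule meas) measurable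
  have "norm (1 - exp (- t * l)) \<le> max 1 l * min 1 t" if "t > 0" for t
  proof -
    have e: "1 - exp (- t * l) \<le> t * l" using exp_ge_add_one_self[of "- t * l"] by simp
    have "1 - exp (- t * l) \<le> max 1 l * min 1 t"
    proof (cases "t \<le> 1")
      case True
      have "t * l \<le> max 1 l * t" using that by (simp add: mult.commute)
      with e True show ?thesis by simp
    next
      case False
      have "1 - exp (- t * l) \<le> 1" by simp
      also have "\<dots> \<le> max 1 l * min 1 t" using False by simp
      finally show ?thesis .
    qed
    moreover have "0 \<le> 1 - exp (- t * l)" using that assms(3) by simp
    ultimately show ?thesis by simp
  qed
  then have "(\<integral>\<^sup>+ t. ennreal (norm (1 - exp (- t * l))) \<partial>\<nu>)
      \<le> (\<integral>\<^sup>+ t. ennreal (max 1 l) * ennreal (min 1 t) \<partial>\<nu>)"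
    by (intro nn_integral_mono) (auto simp: sp ennreal_mult'[symmetric] intro!: ennreal_leI)
  also have "\<dots> = ennreal (max 1 l) * (\<integral>\<^sup>+ t. ennreal (min 1 t) \<partial>\<nu>)"
    by (rule nn_integral_cmult) (intro measurable_compose[OF meas measurable_ennreal]; measurable)
  also have "\<dots> < \<infinity>" using assms(2) by (simp add: ennreal_mult_less_top)
  finally show "(\<integral>\<^sup>+ t. ennreal (norm (1 - exp (- t * l))) \<partial>\<nu>) < \<infinity>" .
qed

end

theory Submission
  imports Defs
begin

text \<open>
  Write \<open>P\<^sub>s = e\<^sup>-\<^sup>s\<^sup>L\<close> for the heat semigroup, that is, \<^term>\<open>fun_of_L (\<lambda>l. exp (- s * l))\<close>. Since
  \<open>1 - e\<^sup>-\<^sup>t\<^sup>l = \<integral>\<^sub>0\<^sup>t l e\<^sup>-\<^sup>s\<^sup>l ds\<close>, the energy \<open>\<langle>f, \<phi>(L) f\<rangle>\<close> is the \<open>\<nu>(dt)\<close>-integral of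
  \<open>\<integral>\<^sub>0\<^sup>t \<langle>L f, P\<^sub>s f\<rangle> ds\<close>. The integrand \<open>\<langle>L f, P\<^sub>s f\<rangle>\<close> is a sum of squares of Walsh coefficients
  with nonnegative weights, so Tonelli's theorem exchanges the two integrals and turns the condition
  \<open>s \<le> t\<close> into the tail \<open>\<eta>(s)\<close> (\<open>energy_eq_heat_integral\<close>).

  For each fixed \<open>s\<close> the vector field enters by integration by parts (\<open>cube_inner_div\<close>):
  \<open>\<langle>L f, P\<^sub>s f\<rangle> = \<langle>div V, P\<^sub>s f\<rangle> = 2 E \<Sum>\<^sub>i V\<^sub>i D\<^sub>i P\<^sub>s f\<close>. The decisive point is that \<open>P\<^sub>s f(x)\<close> averages \<open>f\<close>
  over the point \<open>x\<close> multiplied coordinatewise by the biased signs \<open>\<epsilon>\<close>, so that its derivative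
  falls on the noise instead of on \<open>f\<close> (\<open>cube_D_heat\<close>):
  \<open>D\<^sub>i P\<^sub>s f(x) = (e\<^sup>2\<^sup>s - 1)\<^sup>-\<^sup>1\<^sup>/\<^sup>2 E f(x \<epsilon>) \<delta>\<^sub>i\<close>.
  Summing over \<open>i\<close> against \<open>V\<^sub>i(x)\<close> before taking absolute values, the bound \<open>\<bar>f\<bar> \<le> 1\<close> leaves
  exactly \<open>\<Psi>\<^sub>s(V(x))\<close> (\<open>heat_gradient_le_Psi\<close>), and integrating against \<open>\<eta>(s) ds\<close> gives
  \<open>E \<Gamma>(V)\<close>.
\<close>

section \<open>Walsh coefficients and integration by parts\<close>

lemma cube_expectation_sum:
  "cube_expectation (\<lambda>x. \<Sum>i\<in>I. g i x) = (\<Sum>i\<in>I. cube_expectation (g i))"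
  unfolding cube_expectation_eq by (subst sum.swap) (simp add: sum_divide_distrib)

lemma cube_expectation_cmult: "cube_expectation (\<lambda>x. c * g x) = c * cube_expectation g"
  unfolding cube_expectation_def by simp

lemma cube_expectation_diff:
  "cube_expectation (\<lambda>x. g x - h x) = cube_expectation g - cube_expectation h"
  unfolding cube_expectation_eq by (simp add: sum_subtractf diff_divide_distrib)

lemma cube_expectation_mono:
  assumes "\<And>x. x \<in> cube \<Longrightarrow> g x \<le> h x"
  shows "cube_expectation g \<le> cube_expectation h"
  unfolding cube_expectation_eq using assms by (intro divide_right_mono sum_mono) auto

lemma cube_inner_cong:
  assumes "\<And>x. x \<in> cube \<Longrightarrow> g x = g' x"
  shows "cube_inner g h = cube_inner g' h"
  unfolding cube_inner_def cube_expectation_eq using assms by simp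

lemma cube_inner_fun_of_L:
  "cube_inner g (fun_of_L \<phi> f)
     = (\<Sum>S\<in>UNIV. \<phi> (real (card S)) * cube_inner f (walsh S) * cube_inner g (walsh S))"
proof -
  have "cube_inner g (fun_of_L \<phi> f)
      = cube_expectation (\<lambda>x. \<Sum>S\<in>UNIV. \<phi> (real (card S)) * cube_inner f (walsh S) * (g x * walsh S x))"
    unfolding cube_inner_def[of g] fun_of_L_def by (simp add: sum_distrib_left mult_ac)
  also have "\<dots> = (\<Sum>S\<in>UNIV. \<phi> (real (card S)) * cube_inner f (walsh S) * cube_inner g (walsh S))"
    by (simp add: cube_expectation_sum cube_expectation_cmult cube_inner_def[of g])
  finally show ?thesis .
qed

text \<open>Integration by parts: the flip of coordinate \<open>i\<close> preserves the uniform measure, so it can be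
  moved from \<open>V\<^sub>i\<close> to \<open>g\<close>. The factor 2 compensates the normalisation of \<^const>\<open>cube_D\<close>.\<close>

lemma cube_inner_div:
  "cube_inner (cube_div V) g = 2 * cube_expectation (\<lambda>x. \<Sum>i\<in>UNIV. V x $ i * cube_D i g x)"
proof -
  have "cube_expectation (\<lambda>x. (V x $ i - V (cube_flip i x) $ i) * g x)
      = cube_expectation (\<lambda>x. 2 * (V x $ i * cube_D i g x))" for i
  proof -
    have "cube_expectation (\<lambda>x. V (cube_flip i x) $ i * g x)
        = cube_expectation (\<lambda>x. V x $ i * g (cube_flip i x))"
      using cube_expectation_flip[of "\<lambda>x. V x $ i * g (cube_flip i x)" i] by simp
    moreover have "2 * (V x $ i * cube_D i g x) = V x $ i * g x - V x $ i * g (cube_flip i x)" for x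
      by (simp add: cube_D_def right_diff_distrib)
    ultimately show ?thesis
      by (simp add: left_diff_distrib cube_expectation_diff)
  qed
  then show ?thesis
    unfolding cube_inner_def cube_div_def
    by (simp add: sum_distrib_right cube_expectation_sum cube_expectation_cmult sum_distrib_left)
qed

text \<open>This is the symmetry of \<open>L\<close> against its eigenfunctions. It is an instance of integration by
  parts, because \<open>L f\<close> is the divergence of the field all of whose components are \<open>f / 2\<close>.\<close>

lemma cube_inner_L_walsh: "cube_inner (cube_L f) (walsh S) = real (card S) * cube_inner f (walsh S)"
proof -
  have "cube_L f = cube_div (\<lambda>x. \<chi> i. f x / 2)"
    by (simp add: fun_eq_iff cube_L_def cube_D_def cube_div_def diff_divide_distrib)
  then have "cube_inner (cube_L f) (walsh S) = 2 * cube_expectation (\<lambda>x. \<Sum>i\<in>UNIV. f x / 2 * cube_D i (walsh S) x)"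
    by (simp add: cube_inner_div)
  also have "(\<lambda>x. \<Sum>i\<in>UNIV. f x / 2 * cube_D i (walsh S) x) = (\<lambda>x. real (card S) / 2 * (f x * walsh S x))"
    unfolding sum_distrib_left[symmetric] cube_L_def[symmetric] cube_L_walsh by (simp add: mult_ac)
  finally show ?thesis
    by (simp add: cube_expectation_cmult cube_inner_def del: times_divide_eq_left)
qed

section \<open>Biased signs\<close>

text \<open>The explicit density makes the expectation a finite sum in which \<open>\<rho>\<close> appears only through
  polynomial weights. This yields both the moments below and measurability in the noise parameter.\<close>

lemma eps_law_sum:
  fixes h :: "('n::finite \<Rightarrow> real) \<Rightarrow> real"
  assumes "\<bar>\<rho>\<bar> \<le> 1"
  shows "measure_pmf.expectation (eps_law \<rho>) h
     = (\<Sum>\<epsilon>\<in>UNIV \<rightarrow>\<^sub>E {-1, 1}. (\<Prod>i\<in>UNIV. (1 + \<rho> * \<epsilon> i) / 2) * h \<epsilon>)"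
proof -
  have p: "pmf (map_pmf (\<lambda>b. if b then 1 else - 1) (bernoulli_pmf ((1 + \<rho>) / 2))) z = (1 + \<rho> * z) / 2"
    if "z \<in> {-1, 1}" for z :: real
  proof -
    have "pmf (map_pmf (\<lambda>b. if b then 1 else - 1) (bernoulli_pmf ((1 + \<rho>) / 2))) ((if z = 1 then 1 else -1) :: real)
       = pmf (bernoulli_pmf ((1 + \<rho>) / 2)) (z = 1)"
      using pmf_map_inj'[of "\<lambda>b. if b then 1 else - 1 :: real" _ "z = 1"] by (simp add: inj_def)
    then show ?thesis using that assms by (auto simp: field_simps)
  qed
  have "measure_pmf.expectation (eps_law \<rho>) h
      = (\<Sum>\<epsilon>\<in>UNIV \<rightarrow>\<^sub>E {-1, 1}. h \<epsilon> * pmf (eps_law \<rho>) \<epsilon>)"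
  proof (rule integral_measure_pmf_real)
    show "finite ((UNIV :: 'n set) \<rightarrow>\<^sub>E {-1, 1 :: real})" by (intro finite_PiE) auto
  qed (use eps_law_values in \<open>auto simp: PiE_def\<close>)
  also have "\<dots> = (\<Sum>\<epsilon>\<in>UNIV \<rightarrow>\<^sub>E {-1, 1}. (\<Prod>i\<in>UNIV. (1 + \<rho> * \<epsilon> i) / 2) * h \<epsilon>)"
  proof (rule sum.cong[OF refl])
    fix \<epsilon> assume "\<epsilon> \<in> (UNIV :: 'n set) \<rightarrow>\<^sub>E {-1, 1 :: real}"
    then have "pmf (eps_law \<rho>) \<epsilon> = (\<Prod>i\<in>UNIV. (1 + \<rho> * \<epsilon> i) / 2)"
      unfolding eps_law_def by (subst pmf_Pi') (auto intro!: prod.cong p)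
    then show "h \<epsilon> * pmf (eps_law \<rho>) \<epsilon> = (\<Prod>i\<in>UNIV. (1 + \<rho> * \<epsilon> i) / 2) * h \<epsilon>" by simp
  qed
  finally show ?thesis .
qed

lemma integrable_eps_law [simp]: "integrable (measure_pmf (eps_law \<rho> :: ('n::finite \<Rightarrow> real) pmf)) (h :: _ \<Rightarrow> real)"
proof (rule integrable_measure_pmf_finite)
  have "set_pmf (eps_law \<rho>) \<subseteq> (UNIV :: 'n set) \<rightarrow>\<^sub>E {-1, 1 :: real}"
    using eps_law_values by (auto simp: PiE_def)
  then show "finite (set_pmf (eps_law \<rho> :: ('n \<Rightarrow> real) pmf))"
    by (rule finite_subset) (intro finite_PiE; simp)
qed

lemma eps_law_walsh:
  fixes S :: "'n::finite set"
  assumes "\<bar>\<rho>\<bar> \<le> 1"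
  shows "measure_pmf.expectation (eps_law \<rho>) (\<lambda>\<epsilon>. \<Prod>i\<in>S. \<epsilon> i) = \<rho> ^ card S"
proof -
  have "measure_pmf.expectation (eps_law \<rho>) (\<lambda>\<epsilon>. \<Prod>i\<in>S. \<epsilon> i)
      = (\<Sum>\<epsilon>\<in>UNIV \<rightarrow>\<^sub>E {-1, 1}. \<Prod>i\<in>UNIV. (1 + \<rho> * \<epsilon> i) / 2 * (if i \<in> S then \<epsilon> i else 1))"
    unfolding eps_law_sum[OF assms] prod.distrib by (simp add: prod.If_cases)
  also have "\<dots> = (\<Prod>i\<in>UNIV. \<Sum>z\<in>{-1, 1}. (1 + \<rho> * z) / 2 * (if i \<in> S then z else 1))"
    by (rule prod_sum_PiE[symmetric]) auto
  also have "\<dots> = (\<Prod>i\<in>UNIV. if i \<in> S then \<rho> else 1)"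
    by (intro prod.cong) (auto simp: field_simps)
  also have "\<dots> = \<rho> ^ card S" by (simp add: prod.If_cases)
  finally show ?thesis .
qed

text \<open>Multiplication by \<open>\<epsilon>\<^sub>i\<close> toggles the membership of \<open>i\<close> in \<open>S\<close>, as \<open>\<epsilon>\<^sub>i\<^sup>2 = 1\<close>. The extra factor
  \<open>\<rho>\<close> on the left avoids the exponent \<open>|S| - 1\<close>.\<close>

lemma eps_law_walsh_centered:
  fixes S :: "'n::finite set"
  assumes "\<bar>\<rho>\<bar> \<le> 1"
  shows "\<rho> * measure_pmf.expectation (eps_law \<rho>) (\<lambda>\<epsilon>. (\<Prod>j\<in>S. \<epsilon> j) * (\<epsilon> i - \<rho>))
     = (if i \<in> S then (1 - \<rho>\<^sup>2) * \<rho> ^ card S else 0)"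
proof -
  define T where "T = (if i \<in> S then S - {i} else insert i S)"
  have "(\<Prod>j\<in>S. \<epsilon> j) * \<epsilon> i = (\<Prod>j\<in>T. \<epsilon> j)" if "\<epsilon> \<in> set_pmf (eps_law \<rho>)" for \<epsilon>
  proof (cases "i \<in> S")
    case True
    have "\<epsilon> i * \<epsilon> i = 1" using eps_law_values[OF that, of i] by auto
    then show ?thesis using True by (simp add: T_def prod.remove[of S i] mult_ac)
  qed (simp add: T_def mult.commute)
  then have "measure_pmf.expectation (eps_law \<rho>) (\<lambda>\<epsilon>. (\<Prod>j\<in>S. \<epsilon> j) * (\<epsilon> i - \<rho>))
     = measure_pmf.expectation (eps_law \<rho>) (\<lambda>\<epsilon>. (\<Prod>j\<in>T. \<epsilon> j) - \<rho> * (\<Prod>j\<in>S. \<epsilon> j))"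
    by (intro integral_cong_AE) (auto simp: AE_measure_pmf_iff algebra_simps)
  also have "\<dots> = \<rho> ^ card T - \<rho> * \<rho> ^ card S"
    by (simp add: eps_law_walsh[OF assms])
  finally have *: "measure_pmf.expectation (eps_law \<rho>) (\<lambda>\<epsilon>. (\<Prod>j\<in>S. \<epsilon> j) * (\<epsilon> i - \<rho>))
     = \<rho> ^ card T - \<rho> * \<rho> ^ card S" .
  show ?thesis
  proof (cases "i \<in> S")
    case True
    then have "card S = Suc (card T)" using card_Suc_Diff1[of S i] by (simp add: T_def del: card_Diff_singleton)
    then show ?thesis using True unfolding * by (simp add: algebra_simps power2_eq_square)
  next
    case False
    then show ?thesis unfolding * by (simp add: T_def)
  qed
qed

section \<open>Differentiating the heat semigroup\<close>

lemma cube_mult_in: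
  assumes "x \<in> cube" "\<And>i. \<epsilon> i \<in> {-1, 1}"
  shows "(\<chi> i. x $ i * \<epsilon> i) \<in> cube"
proof -
  have "x $ i * \<epsilon> i \<in> {-1, 1}" for i
    using assms(1) assms(2)[of i] by (auto simp: cube_def minus_equation_iff[of _ 1])
  then show ?thesis by (simp add: cube_def)
qed

lemma cube_D_fun_of_L:
  "cube_D i (fun_of_L \<phi> f) x
     = (\<Sum>S\<in>UNIV. if i \<in> S then \<phi> (real (card S)) * cube_inner f (walsh S) * walsh S x else 0)"
  unfolding cube_D_def fun_of_L_def sum_subtractf[symmetric] sum_divide_distrib
  by (intro sum.cong) (auto simp: walsh_flip)

text \<open>Differentiation of \<open>P\<^sub>t f\<close> is correlation with the noise. By the Walsh expansion it is enough
  to compare both sides on \<open>\<chi>\<^sub>S\<close>: they vanish if \<open>i \<notin> S\<close>, and for \<open>i \<in> S\<close> they equal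
  \<open>\<rho>\<^bsup>|S|\<^esup> \<chi>\<^sub>S(x)\<close>, the two normalising square roots combining to \<open>\<rho> / (1 - \<rho>\<^sup>2)\<close>.\<close>

lemma cube_D_heat:
  fixes f :: "real ^ 'n \<Rightarrow> real"
  assumes x: "x \<in> cube" and t: "t > 0"
  defines "\<rho> \<equiv> exp (- t)"
  shows "cube_D i (fun_of_L (\<lambda>l. exp (- t * l)) f) x = 1 / sqrt (exp (2 * t) - 1) *
     measure_pmf.expectation (eps_law \<rho>)
       (\<lambda>\<epsilon>. f (\<chi> j. x $ j * \<epsilon> j) * ((\<epsilon> i - \<rho>) / sqrt (1 - \<rho>\<^sup>2)))"
proof -
  define E :: "(('n \<Rightarrow> real) \<Rightarrow> real) \<Rightarrow> real"
    where "E = measure_pmf.expectation (eps_law \<rho>)"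
  have \<rho>: "0 < \<rho>" "\<rho> < 1" using t by (auto simp: \<rho>_def)
  have pos: "0 < 1 - \<rho>\<^sup>2" using \<rho> by (simp add: power_less_one_iff)
  have "exp (2 * t) = 1 / \<rho>\<^sup>2"
    by (simp add: \<rho>_def power2_eq_square exp_minus field_simps flip: exp_add)
  then have "exp (2 * t) - 1 = (1 - \<rho>\<^sup>2) / \<rho>\<^sup>2"
    using \<rho> by (simp add: diff_divide_distrib)
  then have "sqrt (exp (2 * t) - 1) = sqrt (1 - \<rho>\<^sup>2) / \<rho>"
    using \<rho> by (simp add: real_sqrt_divide)
  then have c: "1 / sqrt (exp (2 * t) - 1) * (1 / sqrt (1 - \<rho>\<^sup>2)) = \<rho> / (1 - \<rho>\<^sup>2)"
    using pos by simp
  have "E (\<lambda>\<epsilon>. f (\<chi> j. x $ j * \<epsilon> j) * (\<epsilon> i - \<rho>))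
      = E (\<lambda>\<epsilon>. \<Sum>S\<in>UNIV. cube_inner f (walsh S) * walsh S x * ((\<Prod>j\<in>S. \<epsilon> j) * (\<epsilon> i - \<rho>)))"
    unfolding E_def
  proof (rule integral_cong_AE, simp, simp, unfold AE_measure_pmf_iff, rule ballI)
    fix \<epsilon> assume "\<epsilon> \<in> set_pmf (eps_law \<rho> :: ('n \<Rightarrow> real) pmf)"
    then have "(\<chi> j. x $ j * \<epsilon> j) \<in> cube"
      by (intro cube_mult_in[OF x] eps_law_values)
    from walsh_expansion[OF this, of f]
    show "f (\<chi> j. x $ j * \<epsilon> j) * (\<epsilon> i - \<rho>)
      = (\<Sum>S\<in>UNIV. cube_inner f (walsh S) * walsh S x * ((\<Prod>j\<in>S. \<epsilon> j) * (\<epsilon> i - \<rho>)))"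
      by (simp add: walsh_def[of _ "\<chi> j. x $ j * \<epsilon> j"] walsh_def[of _ x] prod.distrib
          sum_distrib_right mult.assoc)
  qed
  also have "\<dots> = (\<Sum>S\<in>UNIV. cube_inner f (walsh S) * walsh S x * E (\<lambda>\<epsilon>. (\<Prod>j\<in>S. \<epsilon> j) * (\<epsilon> i - \<rho>)))"
    unfolding E_def by simp
  finally have "\<rho> * E (\<lambda>\<epsilon>. f (\<chi> j. x $ j * \<epsilon> j) * (\<epsilon> i - \<rho>))
     = (\<Sum>S\<in>UNIV. cube_inner f (walsh S) * walsh S x * (\<rho> * E (\<lambda>\<epsilon>. (\<Prod>j\<in>S. \<epsilon> j) * (\<epsilon> i - \<rho>))))"
    by (simp add: sum_distrib_left mult_ac)
  also have "\<dots> = (\<Sum>S\<in>UNIV. cube_inner f (walsh S) * walsh S x *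
       (if i \<in> S then (1 - \<rho>\<^sup>2) * \<rho> ^ card S else 0))"
    unfolding E_def using \<rho> by (simp add: eps_law_walsh_centered)
  also have "\<dots> = (1 - \<rho>\<^sup>2) * cube_D i (fun_of_L (\<lambda>l. exp (- t * l)) f) x"
    unfolding cube_D_fun_of_L sum_distrib_left
    by (intro sum.cong) (auto simp: \<rho>_def mult_ac simp flip: exp_of_nat_mult)
  finally have "cube_D i (fun_of_L (\<lambda>l. exp (- t * l)) f) x
     = \<rho> / (1 - \<rho>\<^sup>2) * E (\<lambda>\<epsilon>. f (\<chi> j. x $ j * \<epsilon> j) * (\<epsilon> i - \<rho>))"
    using pos by (simp add: field_simps)
  also have "\<dots> = 1 / sqrt (exp (2 * t) - 1) * (E (\<lambda>\<epsilon>. f (\<chi> j. x $ j * \<epsilon> j) * (\<epsilon> i - \<rho>)) / sqrt (1 - \<rho>\<^sup>2))"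
    unfolding c[symmetric] by simp
  also have "E (\<lambda>\<epsilon>. f (\<chi> j. x $ j * \<epsilon> j) * (\<epsilon> i - \<rho>)) / sqrt (1 - \<rho>\<^sup>2)
     = E (\<lambda>\<epsilon>. f (\<chi> j. x $ j * \<epsilon> j) * ((\<epsilon> i - \<rho>) / sqrt (1 - \<rho>\<^sup>2)))"
    unfolding E_def by simp
  finally show ?thesis unfolding E_def .
qed

lemma heat_gradient_le_Psi:
  fixes f :: "real ^ 'n \<Rightarrow> real"
  assumes x: "x \<in> cube" and t: "t > 0" and f: "\<forall>x\<in>cube. f x \<in> {-1..1}"
  shows "(\<Sum>i\<in>UNIV. a $ i * cube_D i (fun_of_L (\<lambda>l. exp (- t * l)) f) x) \<le> Psi t a"
proof -
  define \<rho> where "\<rho> = exp (- t)"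
  define E :: "(('n \<Rightarrow> real) \<Rightarrow> real) \<Rightarrow> real"
    where "E = measure_pmf.expectation (eps_law \<rho>)"
  define \<delta> where "\<delta> = (\<lambda>\<epsilon> (i::'n). (\<epsilon> i - \<rho>) / sqrt (1 - \<rho>\<^sup>2))"
  define c where "c = 1 / sqrt (exp (2 * t) - 1)"
  have "(\<Sum>i\<in>UNIV. a $ i * cube_D i (fun_of_L (\<lambda>l. exp (- t * l)) f) x)
     = c * (\<Sum>i\<in>UNIV. a $ i * E (\<lambda>\<epsilon>. f (\<chi> j. x $ j * \<epsilon> j) * \<delta> \<epsilon> i))"
    unfolding cube_D_heat[OF x t] c_def E_def \<delta>_def \<rho>_def by (simp add: sum_distrib_left mult_ac)
  also have "(\<Sum>i\<in>UNIV. a $ i * E (\<lambda>\<epsilon>. f (\<chi> j. x $ j * \<epsilon> j) * \<delta> \<epsilon> i))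
     = E (\<lambda>\<epsilon>. f (\<chi> j. x $ j * \<epsilon> j) * (\<Sum>i\<in>UNIV. a $ i * \<delta> \<epsilon> i))"
    unfolding E_def sum_distrib_left by (simp add: mult.left_commute[of _ "a $ _"])
  also have "\<dots> \<le> E (\<lambda>\<epsilon>. \<bar>\<Sum>i\<in>UNIV. a $ i * \<delta> \<epsilon> i\<bar>)"
    unfolding E_def
  proof (rule integral_mono_AE, simp, simp, unfold AE_measure_pmf_iff, rule ballI)
    fix \<epsilon> assume "\<epsilon> \<in> set_pmf (eps_law \<rho> :: ('n \<Rightarrow> real) pmf)"
    then have "(\<chi> j. x $ j * \<epsilon> j) \<in> cube"
      by (intro cube_mult_in[OF x] eps_law_values)
    with f have "\<bar>f (\<chi> j. x $ j * \<epsilon> j)\<bar> \<le> 1" by (auto simp: abs_le_iff)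
    then have "\<bar>f (\<chi> j. x $ j * \<epsilon> j) * (\<Sum>i\<in>UNIV. a $ i * \<delta> \<epsilon> i)\<bar> \<le> 1 * \<bar>\<Sum>i\<in>UNIV. a $ i * \<delta> \<epsilon> i\<bar>"
      unfolding abs_mult by (rule mult_right_mono) simp
    then show "f (\<chi> j. x $ j * \<epsilon> j) * (\<Sum>i\<in>UNIV. a $ i * \<delta> \<epsilon> i) \<le> \<bar>\<Sum>i\<in>UNIV. a $ i * \<delta> \<epsilon> i\<bar>"
      by simp
  qed
  finally show ?thesis
    using t unfolding Psi_def Let_def c_def E_def \<delta>_def \<rho>_def by (simp add: mult_left_mono divide_right_mono)
qed

section \<open>Integration against the measure of the Bernstein function\<close>

lemma Psi_nonneg: "t \<ge> 0 \<Longrightarrow> Psi t a \<ge> 0"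
  unfolding Psi_def Let_def by simp

text \<open>The restriction to \<open>t > 0\<close> keeps \<open>\<rho> = e\<^sup>-\<^sup>t\<close> a legitimate mean of a sign; only there is
  the explicit finite sum available.\<close>

lemma Psi_measurable: "(\<lambda>t. Psi t a * indicator {0<..} t) \<in> borel_measurable borel"
proof -
  have "Psi t a * indicator {0<..} t
     = 1 / sqrt (exp (2 * t) - 1) * (\<Sum>\<epsilon>\<in>UNIV \<rightarrow>\<^sub>E {-1, 1}. (\<Prod>i\<in>UNIV. (1 + exp (- t) * \<epsilon> i) / 2) *
         \<bar>\<Sum>i\<in>UNIV. a $ i * ((\<epsilon> i - exp (- t)) / sqrt (1 - (exp (- t))\<^sup>2))\<bar>) * indicator {0<..} t" for t
  proof (cases "t > 0")
    case True
    then have "\<bar>exp (- t)\<bar> \<le> 1" by simp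
    then show ?thesis unfolding Psi_def Let_def by (simp add: eps_law_sum)
  qed simp
  then show ?thesis by simp
qed


context
  fixes \<nu> :: "real measure"
  assumes sets_\<nu>: "sets \<nu> = sets (restrict_space borel {0<..})"
    and fin_\<nu>: "(\<integral>\<^sup>+ t. ennreal (min 1 t) \<partial>\<nu>) < \<infinity>"
begin

lemma space_levy: "space \<nu> = {0<..}"
  using sets_eq_imp_space_eq[OF sets_\<nu>] by (simp add: space_restrict_space)

lemma measurable_levy: "h \<in> measurable borel M \<Longrightarrow> h \<in> measurable \<nu> M"
  using measurable_cong_sets[OF sets_\<nu> refl] measurable_restrict_space1 by blast

lemma tail_in_sets_levy: "s > 0 \<Longrightarrow> {s..} \<in> sets \<nu>"
  unfolding sets_\<nu> by (subst sets_restrict_space_iff) auto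

text \<open>Markov's inequality for the function \<open>min 1\<close>.\<close>

lemma eta_finite:
  assumes "s > 0"
  shows "eta \<nu> s < \<infinity>"
proof -
  have "ennreal (min 1 s) * eta \<nu> s = (\<integral>\<^sup>+ t. ennreal (min 1 s) * indicator {s..} t \<partial>\<nu>)"
    unfolding eta_def using tail_in_sets_levy[OF assms] by (rule nn_integral_cmult_indicator[symmetric])
  also have "\<dots> \<le> (\<integral>\<^sup>+ t. ennreal (min 1 t) \<partial>\<nu>)"
    by (intro nn_integral_mono) (auto simp: indicator_def intro!: ennreal_leI)
  also note fin_\<nu>
  finally show ?thesis using assms by (auto simp: ennreal_mult_less_top)
qed

lemma sigma_finite_levy: "sigma_finite_measure \<nu>"
proof (standard, intro exI conjI ballI)
  let ?A = "range (\<lambda>n::nat. {inverse (real (Suc n))..})"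
  show "countable ?A" by simp
  show "?A \<subseteq> sets \<nu>" using tail_in_sets_levy by auto
  show "\<Union> ?A = space \<nu>"
  proof
    have "0 < t" if "inverse (real (Suc n)) \<le> t" for t n
      by (rule less_le_trans[OF _ that]) simp
    then show "\<Union> ?A \<subseteq> space \<nu>" unfolding space_levy by blast
    show "space \<nu> \<subseteq> \<Union> ?A"
    proof
      fix t assume "t \<in> space \<nu>"
      then obtain n where "inverse (real (Suc n)) < t"
        using reals_Archimedean unfolding space_levy by blast
      then have "t \<in> {inverse (real (Suc n))..}" by simp
      then show "t \<in> \<Union> ?A" by blast
    qed
  qed
  show "emeasure \<nu> a \<noteq> \<infinity>" if "a \<in> ?A" for a
    using that eta_finite unfolding eta_def by (auto simp: less_top)
qed

text \<open>The measure \<open>\<nu>\<close> may have infinite mass near \<open>0\<close>, but it is sigma-finite, as Tonelli's theorem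
  requires. After the exchange the \<open>\<nu>\<close>-integral is a tail of \<open>\<nu>\<close>; this also shows that the tail is measurable
  in \<open>s\<close>.\<close>

lemma levy_tonelli:
  fixes h :: "real \<Rightarrow> ennreal"
  assumes h: "h \<in> borel_measurable borel"
  shows "(\<integral>\<^sup>+ t. (\<integral>\<^sup>+ s. h s * indicator {0<..t} s \<partial>lborel) \<partial>\<nu>)
       = (\<integral>\<^sup>+ s\<in>{0<..}. eta \<nu> s * h s \<partial>lborel)"
    and "(\<lambda>s. eta \<nu> s * h s * indicator {0<..} s) \<in> borel_measurable borel"
proof -
  interpret sigma_finite_measure \<nu> by (rule sigma_finite_levy)
  interpret pair_sigma_finite \<nu> lborel ..
  note [measurable] = h measurable_levy[of "\<lambda>x. x" borel, OF measurable_ident_sets[OF refl]]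
  define k where "k = (\<lambda>t s. h s * indicator {0<..t} s)"
  have k: "k t s = (if 0 < s \<and> s \<le> t then h s else 0)" for t s
    by (simp add: k_def indicator_def)
  have k_meas [measurable]: "case_prod k \<in> borel_measurable (\<nu> \<Otimes>\<^sub>M lborel)"
    unfolding k by measurable
  have tail: "(\<integral>\<^sup>+ t. k t s \<partial>\<nu>) = eta \<nu> s * h s * indicator {0<..} s" for s
  proof (cases "s > 0")
    case True
    then have "(\<integral>\<^sup>+ t. k t s \<partial>\<nu>) = (\<integral>\<^sup>+ t. h s * indicator {s..} t \<partial>\<nu>)"
      by (intro nn_integral_cong) (simp add: k indicator_def)
    also have "\<dots> = h s * eta \<nu> s"
      unfolding eta_def using tail_in_sets_levy[OF True] by (rule nn_integral_cmult_indicator)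
    finally show ?thesis using True by (simp add: mult.commute)
  qed (simp add: k)
  show "(\<integral>\<^sup>+ t. (\<integral>\<^sup>+ s. h s * indicator {0<..t} s \<partial>lborel) \<partial>\<nu>)
       = (\<integral>\<^sup>+ s\<in>{0<..}. eta \<nu> s * h s \<partial>lborel)"
    using Fubini'[OF k_meas] unfolding tail by (simp add: k_def)
  have "(\<lambda>s. \<integral>\<^sup>+ t. k t s \<partial>\<nu>) \<in> borel_measurable lborel"
    by measurable
  then show "(\<lambda>s. eta \<nu> s * h s * indicator {0<..} s) \<in> borel_measurable borel"
    unfolding tail by simp
qed

text \<open>All integrands are nonnegative, because
  \<open>\<langle>L f, P\<^sub>s f\<rangle> = \<Sum>\<^sub>S |S| e\<^bsup>-s|S|\<^esup> \<langle>f, \<chi>\<^sub>S\<rangle>\<^sup>2\<close>. Hence the exchange of integrals takes place in the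
  extended nonnegative reals.\<close>

lemma energy_eq_heat_integral:
  fixes f :: "real ^ 'n \<Rightarrow> real"
  shows "ennreal (cube_inner f (fun_of_L (bernstein_of \<nu>) f))
    = (\<integral>\<^sup>+ s\<in>{0<..}. eta \<nu> s *
         ennreal (cube_inner (cube_L f) (fun_of_L (\<lambda>l. exp (- s * l)) f)) \<partial>lborel)"
proof -
  define c where "c = (\<lambda>S. cube_inner f (walsh S))"
  define g where "g = (\<lambda>s. cube_inner (cube_L f) (fun_of_L (\<lambda>l. exp (- s * l)) f))"
  have g: "g s = (\<Sum>S\<in>UNIV. real (card S) * exp (- s * real (card S)) * (c S)\<^sup>2)" for s
    unfolding g_def cube_inner_fun_of_L cube_inner_L_walsh
    by (intro sum.cong) (auto simp: c_def power2_eq_square)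
  have g_meas [measurable]: "g \<in> borel_measurable borel"
    unfolding g by measurable
  define G where "G = (\<lambda>t. \<Sum>S\<in>UNIV. (1 - exp (- t * real (card S))) * (c S)\<^sup>2)"
  have int: "integrable \<nu> (\<lambda>t. 1 - exp (- t * real (card S)))" for S :: "'n set"
    by (rule bernstein_integrable[OF sets_\<nu> fin_\<nu>]) simp
  have "cube_inner f (fun_of_L (bernstein_of \<nu>) f) = (LINT t|\<nu>. G t)"
    unfolding cube_inner_fun_of_L bernstein_of_def G_def
    using int by (simp add: c_def power2_eq_square mult.assoc)
  also have "ennreal \<dots> = (\<integral>\<^sup>+ t. ennreal (G t) \<partial>\<nu>)"
  proof (rule nn_integral_eq_integral[symmetric])
    show "integrable \<nu> G" unfolding G_def using int by simp
    show "AE t in \<nu>. 0 \<le> G t"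
      unfolding G_def by (intro AE_I2 sum_nonneg mult_nonneg_nonneg) (auto simp: space_levy)
  qed
  also have "\<dots> = (\<integral>\<^sup>+ t. (\<integral>\<^sup>+ s. ennreal (g s) * indicator {0<..t} s \<partial>lborel) \<partial>\<nu>)"
  proof (rule nn_integral_cong)
    fix t assume "t \<in> space \<nu>"
    then have t: "0 \<le> t" by (simp add: space_levy)
    have "(\<integral>\<^sup>+ s. ennreal (g s) * indicator {0<..t} s \<partial>lborel)
        = (\<integral>\<^sup>+ s. ennreal (g s) * indicator {0..t} s \<partial>lborel)"
      using AE_lborel_singleton[of "0::real"]
      by (intro nn_integral_cong_AE) (auto simp: indicator_def)
    also have "\<dots> = G t - G 0"
    proof (rule nn_integral_FTC_Icc[OF _ _ _ t])
      show "(G has_real_derivative g s) (at s)" for s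
        unfolding G_def g by (auto intro!: derivative_eq_intros sum.cong)
      show "0 \<le> g s" for s
        unfolding g by (intro sum_nonneg) simp
    qed measurable
    finally show "ennreal (G t) = (\<integral>\<^sup>+ s. ennreal (g s) * indicator {0<..t} s \<partial>lborel)"
      by (simp add: G_def)
  qed
  also have "\<dots> = (\<integral>\<^sup>+ s\<in>{0<..}. eta \<nu> s * ennreal (g s) \<partial>lborel)"
    by (rule levy_tonelli) measurable
  finally show ?thesis unfolding g_def .
qed

text \<open>Moving the average over the cube inside the \<open>s\<close>-integral reduces the theorem to a comparison
  of integrands at each fixed \<open>s\<close>.\<close>

lemma expectation_Gamma_phi:
  fixes V :: "real ^ 'n \<Rightarrow> real ^ 'n"
  shows "(\<integral>\<^sup>+ x. Gamma_phi \<nu> (V x) \<partial>pmf_of_set cube)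
     = (\<integral>\<^sup>+ s\<in>{0<..}. eta \<nu> s * ennreal (2 * cube_expectation (\<lambda>x. Psi s (V x))) \<partial>lborel)"
proof -
  let ?N = "ennreal (1 / real (card (cube :: (real ^ 'n) set)))"
  define h where "h = (\<lambda>x s. eta \<nu> s * ennreal (Psi s (V x)) * indicator {0<..} s)"
  have [measurable]: "h x \<in> borel_measurable borel" for x
  proof -
    have "(\<lambda>s. ennreal (Psi s (V x) * indicator {0<..} s)) \<in> borel_measurable borel"
      by (rule measurable_compose[OF Psi_measurable measurable_ennreal])
    note levy_tonelli(2)[OF this]
    moreover have "eta \<nu> s * ennreal (Psi s (V x) * indicator {0<..} s) * indicator {0<..} s = h x s" for s
      by (simp add: h_def indicator_def)
    ultimately show ?thesis by simp
  qed
  have Gamma: "Gamma_phi \<nu> (V x) = 2 * (\<integral>\<^sup>+ s. h x s \<partial>lborel)" for x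
    by (simp add: Gamma_phi_def h_def)
  have "(\<integral>\<^sup>+ x. Gamma_phi \<nu> (V x) \<partial>pmf_of_set cube) = (\<Sum>x\<in>cube. Gamma_phi \<nu> (V x) * ?N)"
    by (subst nn_integral_measure_pmf_finite) (auto simp: divide_simps)
  also have "\<dots> = (\<Sum>x\<in>cube. \<integral>\<^sup>+ s. 2 * ?N * h x s \<partial>lborel)"
    unfolding Gamma by (subst nn_integral_cmult) (auto simp: mult_ac)
  also have "\<dots> = (\<integral>\<^sup>+ s. (\<Sum>x\<in>cube. 2 * ?N * h x s) \<partial>lborel)"
    by (intro nn_integral_sum[symmetric]) measurable
  also have "\<dots> = (\<integral>\<^sup>+ s\<in>{0<..}. eta \<nu> s * ennreal (2 * cube_expectation (\<lambda>x. Psi s (V x))) \<partial>lborel)"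
  proof (rule nn_integral_cong)
    fix s :: real
    show "(\<Sum>x\<in>cube. 2 * ?N * h x s)
       = eta \<nu> s * ennreal (2 * cube_expectation (\<lambda>x. Psi s (V x))) * indicator {0<..} s"
    proof (cases "s > 0")
      case True
      have "ennreal (2 * cube_expectation (\<lambda>x. Psi s (V x))) = (\<Sum>x\<in>cube. 2 * ?N * ennreal (Psi s (V x)))"
      proof -
        have P: "0 \<le> Psi s (V x)" for x using True by (simp add: Psi_nonneg)
        have "2 * ?N * ennreal (Psi s (V x)) = ennreal (2 * (1 / real (card (cube :: (real ^ 'n) set))) * Psi s (V x))" for x
          by (simp only: ennreal_mult'' P ennreal_numeral zero_le_numeral zero_le_divide_iff of_nat_0_le_iff zero_le_one
              ennreal_mult' simp_thms)
        then show ?thesis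
          using P by (simp add: cube_expectation_eq sum_divide_distrib sum_distrib_left sum_ennreal)
      qed
      then show ?thesis using True by (simp add: h_def sum_distrib_left mult_ac)
    qed (simp add: h_def)
  qed
  finally show ?thesis .
qed

lemma energy_le_Gamma_phi:
  fixes f :: "real ^ 'n \<Rightarrow> real" and V :: "real ^ 'n \<Rightarrow> real ^ 'n"
  assumes f: "\<forall>x\<in>cube. f x \<in> {-1..1}" and V: "\<forall>x\<in>cube. cube_div V x = cube_L f x"
  shows "ennreal (cube_inner f (fun_of_L (bernstein_of \<nu>) f))
           \<le> (\<integral>\<^sup>+ x. Gamma_phi \<nu> (V x) \<partial>pmf_of_set cube)"
  unfolding energy_eq_heat_integral expectation_Gamma_phi
proof (rule nn_integral_mono)
  fix s :: real
  let ?P = "fun_of_L (\<lambda>l. exp (- s * l)) f"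
  have "cube_inner (cube_L f) ?P \<le> 2 * cube_expectation (\<lambda>x. Psi s (V x))" if "s > 0"
  proof -
    have "cube_inner (cube_L f) ?P = cube_inner (cube_div V) ?P"
      using V by (intro cube_inner_cong) simp
    also have "\<dots> = 2 * cube_expectation (\<lambda>x. \<Sum>i\<in>UNIV. V x $ i * cube_D i ?P x)"
      by (rule cube_inner_div)
    also have "\<dots> \<le> 2 * cube_expectation (\<lambda>x. Psi s (V x))"
      using heat_gradient_le_Psi[OF _ that f] by (intro mult_left_mono cube_expectation_mono) auto
    finally show ?thesis .
  qed
  then show "eta \<nu> s * ennreal (cube_inner (cube_L f) ?P) * indicator {0<..} s
     \<le> eta \<nu> s * ennreal (2 * cube_expectation (\<lambda>x. Psi s (V x))) * indicator {0<..} s"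
    by (auto simp: indicator_def intro!: mult_left_mono ennreal_leI)
qed

end


theorem theorem6p2:
  fixes \<nu> :: "real measure" and f :: "real ^ 'n \<Rightarrow> real"
  assumes "sets \<nu> = sets (restrict_space borel {0<..})"
    and "(\<integral>\<^sup>+ t. ennreal (min 1 t) \<partial>\<nu>) < \<infinity>"
    and "\<forall>x\<in>cube. f x \<in> {-1..1}"
  shows "(\<forall>V :: real ^ 'n \<Rightarrow> real ^ 'n. (\<forall>x\<in>cube. cube_div V x = cube_L f x) \<longrightarrow>
           ennreal (cube_inner f (fun_of_L (bernstein_of \<nu>) f))
             \<le> (\<integral>\<^sup>+ x. Gamma_phi \<nu> (V x) \<partial>pmf_of_set cube))
       \<and> ennreal (cube_inner f (fun_of_L (bernstein_of \<nu>) f))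
           \<le> (INF V \<in> {V :: real ^ 'n \<Rightarrow> real ^ 'n. \<forall>x\<in>cube. cube_div V x = cube_L f x}.
                \<integral>\<^sup>+ x. Gamma_phi \<nu> (V x) \<partial>pmf_of_set cube)"
  using energy_le_Gamma_phi[OF assms(1,2,3)] by (auto intro!: INF_greatest)

end
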